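(* Let $p$ be a prime. The operator $\mathscr{S}$ on $C(\mathbb{Z}_p,\mathbb{C}_p)$ defined by $\mathscr{S}(\phi)(x) = \phi(x) - x\phi(x-1)$ is self-adjoint with respect to the pairing $\langle\phi,\psi\rangle = \int_{\mathbb{Z}_p}\phi\,d\mu(H_\psi)$, that is, $$\langle\mathscr{S}(\phi),\psi\rangle = \langle\phi,\mathscr{S}(\psi)\rangle$$ for all $\phi,\psi \in C(\mathbb{Z}_p,\mathbb{C}_p)$.
   Context: $C(\mathbb{Z}_p,\mathbb{C}_p)$ is the $\mathbb{C}_p$-vector space of continuous functions $\mathbb{Z}_p \to \mathbb{C}_p$. For $n\ge0$, $\beta_n(x) = \binom{x}{n}$; every $\phi \in C(\mathbb{Z}_p,\mathbb{C}_p)$ is uniquely $\sum_{n\ge0}a_n\beta_n$ with $a_n \in \mathbb{C}_p$, $a_n\to0$ (Mahler coefficients). A measure is a bounded linear functional $\mu : C(\mathbb{Z}_p,\mathbb{C}_p)\to\mathbb{C}_p$, and $\int_{\mathbb{Z}_p}\phi\,d\mu$ means $\mu(\phi)$. A power series $G(t) = \sum_{n\ge0}b_nt^n \in \mathbb{C}_p[[t]]$ with bounded coefficients defines a measure $\mu(G)$ by $\int_{\mathbb{Z}_p}\phi\,d\mu(G) = \sum_{n\ge0}a_nb_n$, where $(a_n)$ are the Mahler coefficients of $\phi$. For $\psi \in C(\mathbb{Z}_p,\mathbb{C}_p)$, $H_\psi(t) = \sum_{n\ge0}(-1)^n\psi(-1-n)t^n$. *)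

theory Defs
  imports "HOL-Analysis.Analysis" "HOL-Computational_Algebra.Formal_Power_Series"
    "HOL-Computational_Algebra.Primes"
begin

text \<open>
  Complete non-archimedean valued fields of characteristic 0. The library class
  \<open>real_normed_field\<close> is no option: it makes the field an algebra over the reals and so forces
  an archimedean norm. Definiteness and \<open>absval (- x) = absval x\<close> follow from \<open>dist_absval\<close>.
\<close>

class complete_nonarch_field = field_char_0 + complete_space +
  fixes absval :: "'a \<Rightarrow> real"
  assumes dist_absval: "dist x y = absval (x - y)"
    and absval_mult: "absval (x * y) = absval x * absval y"
    and absval_add: "absval (x + y) \<le> max (absval x) (absval y)"

lemma absval_zero_iff: "absval x = 0 \<longleftrightarrow> x = 0"
  using dist_eq_0_iff[of x 0] by (simp add: dist_absval)

lemma absval_nonneg: "0 \<le> absval x"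
  using zero_le_dist[of x 0] by (simp only: dist_absval diff_zero)

lemma absval_uminus: "absval (- x) = absval x"
  using dist_commute[of 0 x] by (simp only: dist_absval diff_zero diff_0)

lemma absval_one: "absval (1 :: 'a::complete_nonarch_field) = 1"
  using absval_mult[of "1 :: 'a" 1] absval_zero_iff[of "1 :: 'a"] by auto

lemma absval_diff: "absval (x - y) \<le> max (absval x) (absval y)"
  using absval_add[of x "- y"] by (simp only: absval_uminus diff_conv_add_uminus)

lemma absval_add_le: "absval (x + y) \<le> absval x + absval y"
  using absval_add[of x y] absval_nonneg[of x] absval_nonneg[of y] by linarith

lemma nonarch_tendsto_iff:
  fixes f :: "'b \<Rightarrow> 'a::complete_nonarch_field"
  shows "(f \<longlongrightarrow> l) F \<longleftrightarrow> ((\<lambda>x. absval (f x - l)) \<longlongrightarrow> 0) F"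
  using tendsto_dist_iff[of f l F] by (simp only: dist_absval)

instance complete_nonarch_field \<subseteq> topological_ab_group_add
proof
  fix a b :: 'a
  have f: "((\<lambda>x. absval (fst x - a)) \<longlongrightarrow> 0) (nhds a \<times>\<^sub>F nhds b)"
    "((\<lambda>x. absval (snd x - b)) \<longlongrightarrow> 0) (nhds a \<times>\<^sub>F nhds b)"
    unfolding nonarch_tendsto_iff[symmetric] by (rule filterlim_fst filterlim_snd)+
  show "((\<lambda>x. fst x + snd x) \<longlongrightarrow> a + b) (nhds a \<times>\<^sub>F nhds b)"
    unfolding nonarch_tendsto_iff
  proof (rule tendsto_sandwich[OF _ _ tendsto_const])
    show "((\<lambda>x. absval (fst x - a) + absval (snd x - b)) \<longlongrightarrow> 0) (nhds a \<times>\<^sub>F nhds b)"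
      using tendsto_add[OF f] by simp
    show "\<forall>\<^sub>F x in nhds a \<times>\<^sub>F nhds b.
        absval (fst x + snd x - (a + b)) \<le> absval (fst x - a) + absval (snd x - b)"
      by (intro always_eventually allI)
        (metis add_diff_add absval_add_le)
  qed (simp add: absval_nonneg)
next
  fix a :: 'a
  have "((\<lambda>x. absval (x - a)) \<longlongrightarrow> 0) (nhds a)"
    unfolding nonarch_tendsto_iff[symmetric] by (rule filterlim_ident)
  moreover have "absval (- x - - a) = absval (x - a)" for x
    using absval_uminus[of "x - a"] by simp
  ultimately show "(uminus \<longlongrightarrow> - a) (nhds a)"
    unfolding nonarch_tendsto_iff by simp
qed

instance complete_nonarch_field \<subseteq> topological_comm_monoid_mult
proof
  fix a b :: 'a
  let ?F = "nhds a \<times>\<^sub>F nhds b"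
  have f: "((\<lambda>x. absval (fst x - a)) \<longlongrightarrow> 0) ?F" "((\<lambda>x. absval (snd x - b)) \<longlongrightarrow> 0) ?F"
    unfolding nonarch_tendsto_iff[symmetric] by (rule filterlim_fst filterlim_snd)+
  show "((\<lambda>x. fst x * snd x) \<longlongrightarrow> a * b) ?F"
    unfolding nonarch_tendsto_iff
  proof (rule tendsto_sandwich[OF _ _ tendsto_const])
    show "((\<lambda>x. absval (fst x - a) * absval (snd x - b) + absval a * absval (snd x - b)
        + absval (fst x - a) * absval b) \<longlongrightarrow> 0) ?F"
      using tendsto_add[OF tendsto_add[OF tendsto_mult[OF f] tendsto_mult[OF tendsto_const f(2)]]
          tendsto_mult[OF f(1) tendsto_const]] by simp
    have "absval (u * v - a * b)
        \<le> absval (u - a) * absval (v - b) + absval a * absval (v - b) + absval (u - a) * absval b" for u v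
    proof -
      have "u * v - a * b = (u - a) * (v - b) + a * (v - b) + (u - a) * b"
        by (simp add: algebra_simps)
      then show ?thesis
        using absval_add_le[of "(u - a) * (v - b) + a * (v - b)" "(u - a) * b"]
          absval_add_le[of "(u - a) * (v - b)" "a * (v - b)"]
        by (simp add: absval_mult)
    qed
    then show "\<forall>\<^sub>F x in ?F. absval (fst x * snd x - a * b)
        \<le> absval (fst x - a) * absval (snd x - b) + absval a * absval (snd x - b)
          + absval (fst x - a) * absval b"
      by simp
  qed (simp add: absval_nonneg)
qed


text \<open>
  \<open>\<complex>\<^sub>p\<close> is the completion of an algebraic closure of \<open>\<rat>\<^sub>p\<close>, which is the completion of \<open>\<rat>\<close> for
  the \<open>p\<close>-adic absolute value. The ambient type is complete, so inside it a completion of a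
  subfield is its topological closure; in particular \<open>closure \<rat>\<close> is \<open>\<rat>\<^sub>p\<close> as soon as \<open>absval\<close>
  restricts to the \<open>p\<close>-adic absolute value on the integers, hence on the rationals.
\<close>

definition is_subfield :: "'a::field set \<Rightarrow> bool" where
  "is_subfield L \<longleftrightarrow> 0 \<in> L \<and> 1 \<in> L
     \<and> (\<forall>x\<in>L. \<forall>y\<in>L. x - y \<in> L \<and> x * y \<in> L) \<and> (\<forall>x\<in>L. inverse x \<in> L)"

definition algebraic_over :: "'a::field set \<Rightarrow> 'a \<Rightarrow> bool" where
  "algebraic_over F x \<longleftrightarrow> (\<exists>q. q \<noteq> 0 \<and> (\<forall>i. poly.coeff q i \<in> F) \<and> poly q x = 0)"

definition algebraically_closed_subfield :: "'a::field set \<Rightarrow> bool" where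
  "algebraically_closed_subfield L \<longleftrightarrow> is_subfield L
     \<and> (\<forall>q. (\<forall>i. poly.coeff q i \<in> L) \<longrightarrow> degree q > 0 \<longrightarrow> (\<exists>x\<in>L. poly q x = 0))"

definition is_algebraic_closure_of :: "'a::field set \<Rightarrow> 'a set \<Rightarrow> bool" where
  "is_algebraic_closure_of F L \<longleftrightarrow>
     F \<subseteq> L \<and> algebraically_closed_subfield L \<and> (\<forall>x\<in>L. algebraic_over F x)"

definition is_Cp :: "nat \<Rightarrow> 'a::complete_nonarch_field itself \<Rightarrow> bool" where
  "is_Cp p (_ :: 'a itself) \<longleftrightarrow>
     (\<forall>k::int. k \<noteq> 0 \<longrightarrow> absval (of_int k :: 'a) = (1 / real p) ^ multiplicity (int p) k)
     \<and> (\<exists>L :: 'a set. is_algebraic_closure_of (closure \<rat>) L \<and> closure L = UNIV)"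

text \<open>The ring of integers of \<open>\<rat>\<^sub>p = closure \<rat>\<close>.\<close>

definition Zp :: "'a::complete_nonarch_field set" where
  "Zp = {x \<in> closure \<rat>. absval x \<le> 1}"

text \<open>
  Elements of \<open>C(\<int>\<^sub>p, \<complex>\<^sub>p)\<close> are represented by functions on the whole type; values outside \<open>Zp\<close>
  are unconstrained. The Mahler coefficients, the pairing and \<open>S_op \<phi>\<close> on \<open>Zp\<close> depend only on
  values on \<open>Zp\<close>.
\<close>

definition CZp :: "('a::complete_nonarch_field \<Rightarrow> 'a) set" where
  "CZp = {\<phi>. continuous_on Zp \<phi>}"

text \<open>
  Since \<open>absval (x gchoose n) \<le> 1\<close> on \<open>\<int>\<^sub>p\<close>, for \<open>a \<longlonglongrightarrow> 0\<close> the Mahler series converges uniformly,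
  so pointwise convergence to \<open>\<phi>\<close> is the same as convergence in \<open>C(\<int>\<^sub>p, \<complex>\<^sub>p)\<close>.
\<close>

definition mahler_coeffs :: "('a::complete_nonarch_field \<Rightarrow> 'a) \<Rightarrow> nat \<Rightarrow> 'a" where
  "mahler_coeffs \<phi> =
     (THE a. a \<longlonglongrightarrow> 0 \<and> (\<forall>x\<in>Zp. (\<lambda>n. a n * (x gchoose n)) sums \<phi> x))"

text \<open>
  A measure is a functional on \<open>CZp\<close>, the integral being its application. The functional below is
  of interest for \<open>G\<close> with bounded coefficients, where the series converges.
\<close>

definition measure_of_fps ::
    "'a::complete_nonarch_field fps \<Rightarrow> ('a \<Rightarrow> 'a) \<Rightarrow> 'a" where
  "measure_of_fps G \<phi> = (\<Sum>n. mahler_coeffs \<phi> n * fps_nth G n)"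

definition H_series :: "('a::complete_nonarch_field \<Rightarrow> 'a) \<Rightarrow> 'a fps" where
  "H_series \<psi> = Abs_fps (\<lambda>n. (-1) ^ n * \<psi> (-1 - of_nat n))"

definition pairing ::
    "('a::complete_nonarch_field \<Rightarrow> 'a) \<Rightarrow> ('a \<Rightarrow> 'a) \<Rightarrow> 'a" where
  "pairing \<phi> \<psi> = measure_of_fps (H_series \<psi>) \<phi>"

definition S_op ::
    "('a::complete_nonarch_field \<Rightarrow> 'a) \<Rightarrow> ('a \<Rightarrow> 'a)" where
  "S_op \<phi> = (\<lambda>x. \<phi> x - x * \<phi> (x - 1))"

lemma Zp_diff_one:
  assumes "x \<in> Zp"
  shows "x - 1 \<in> (Zp :: 'a::complete_nonarch_field set)"
proof -
  from assms have x: "x \<in> closure \<rat>" "absval x \<le> 1"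
    by (auto simp: Zp_def)
  from x(1) obtain u where u: "\<And>n. u n \<in> \<rat>" "u \<longlonglongrightarrow> x"
    unfolding closure_sequential by blast
  have "(\<lambda>n. u n - 1) \<longlonglongrightarrow> x - 1"
    by (intro tendsto_intros u)
  moreover have "u n - 1 \<in> \<rat>" for n
    using u(1) by simp
  ultimately have "x - 1 \<in> closure \<rat>"
    unfolding closure_sequential by (intro exI[of _ "\<lambda>n. u n - 1"]) auto
  moreover have "absval (x - 1) \<le> 1"
    using absval_diff[of x 1] x(2) by (simp add: absval_one)
  ultimately show ?thesis
    by (simp add: Zp_def)
qed

lemma S_op_CZp:
  assumes "\<phi> \<in> CZp"
  shows "S_op \<phi> \<in> CZp"
proof -
  have c: "continuous_on Zp \<phi>"
    using assms by (simp add: CZp_def)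
  have "continuous_on Zp (\<lambda>x. \<phi> (x - 1))"
    by (rule continuous_on_compose2[OF c continuous_on_diff[OF continuous_on_id continuous_on_const]])
      (use Zp_diff_one in blast)
  then have "continuous_on Zp (\<lambda>x. \<phi> x - x * \<phi> (x - 1))"
    by (rule continuous_on_diff[OF c continuous_on_mult'[OF continuous_on_id]])
  then show ?thesis
    by (simp add: CZp_def S_op_def)
qed

end

theory Submission
  imports Defs
begin

text \<open>
  Put \<open>c n = (-1) ^ n * \<psi> (-1 - n)\<close>, the coefficients of \<open>H_series \<psi>\<close>, and let \<open>a\<close> be the Mahler
  coefficients of \<open>\<phi>\<close>. By the absorption identity \<open>x * binom (x - 1) n = (n + 1) * binom x (n + 1)\<close>,
  the Mahler coefficients of \<open>S_op \<phi>\<close> are \<open>a n - n * a (n - 1)\<close>; directly from the definition,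
  the coefficients of \<open>H_series (S_op \<psi>)\<close> are \<open>c n - (n + 1) * c (n + 1)\<close>. Hence the two pairings
  are the sums of \<open>a n * c n - n * a (n - 1) * c n\<close> and of
  \<open>a n * c n - (n + 1) * a n * c (n + 1)\<close>. Shifting the index shows that their partial sums
  differ by the single term \<open>N * a (N - 1) * c N\<close>, which tends to \<open>0\<close> because \<open>a\<close> does, \<open>c\<close> is
  bounded (\<open>\<int>\<^sub>p\<close> is compact) and integers have absolute value at most \<open>1\<close>.

  What needs work is that Mahler coefficients exist (\<open>mahler_expansion_exists\<close>). They are the
  iterated differences \<open>\<Delta>\<^sup>n \<phi> 0\<close>, and Newton's forward formula gives the expansion at natural
  numbers. That they tend to \<open>0\<close> follows an argument of Bojanic. By uniform continuity, for
  \<open>q = p\<^sup>t\<close> large \<open>\<phi>\<close> is almost \<open>q\<close>-periodic. Since \<open>(1 + \<Delta>)\<^sup>q\<close> is the shift by \<open>q\<close> and \<open>p\<close> divides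
  the inner binomial coefficients of \<open>q\<close>, the operator \<open>\<Delta>\<^sup>q\<close> then shrinks the supremum norm
  by the factor \<open>1 / p\<close>, up to the error in periodicity, and iterating it makes the differences
  small. Finally the expansion passes from the natural numbers to \<open>\<int>\<^sub>p\<close> by density: a bound
  for the tail of the Mahler series is a closed condition.
\<close>

section \<open>Ultrametric absolute values\<close>

lemma absval_sum_le:
  fixes f :: "'b \<Rightarrow> 'a::complete_nonarch_field"
  assumes "\<And>i. i \<in> A \<Longrightarrow> absval (f i) \<le> B" and "0 \<le> B"
  shows "absval (sum f A) \<le> B"
  using assms
proof (induction A rule: infinite_finite_induct)
  case (insert x F)
  then show ?case
    using absval_add[of "f x" "sum f F"] by fastforce
qed (simp_all add: absval_zero_iff[THEN iffD2])

lemma absval_power: "absval (x ^ n) = absval (x :: 'a::complete_nonarch_field) ^ n"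
  by (induction n) (simp_all add: absval_one absval_mult)

lemma continuous_on_absval:
  fixes f :: "'b::topological_space \<Rightarrow> 'a::complete_nonarch_field"
  assumes "continuous_on S f"
  shows "continuous_on S (\<lambda>x. absval (f x))"
proof -
  have "absval (f x) = dist (f x) 0" for x
    by (simp add: dist_absval)
  then show ?thesis
    using assms by (auto intro!: continuous_intros)
qed

lemma continuous_on_gbinomial:
  "continuous_on S (\<lambda>x :: 'a::complete_nonarch_field. x gchoose n)"
  unfolding gbinomial_prod_rev divide_inverse by (intro continuous_intros)

section \<open>Forward differences\<close>

definition forward_diff :: "(nat \<Rightarrow> 'a::ab_group_add) \<Rightarrow> nat \<Rightarrow> 'a" where
  "forward_diff f x = f (Suc x) - f x"

lemma forward_diff_Suc:
  "(forward_diff ^^ Suc j) f x = (forward_diff ^^ j) f (Suc x) - (forward_diff ^^ j) f x"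
  by (simp add: forward_diff_def[of "(forward_diff ^^ j) f"])

text \<open>The binomial expansion of the shift \<open>(1 + \<Delta>)\<^sup>m\<close>.\<close>

lemma newton_forward:
  fixes f :: "nat \<Rightarrow> 'a::comm_ring_1"
  shows "f (x + m) = (\<Sum>j\<le>m. of_nat (m choose j) * (forward_diff ^^ j) f x)"
proof (induction m arbitrary: x)
  case (Suc m)
  let ?u = "\<lambda>j. (forward_diff ^^ j) f x"
  have step: "(forward_diff ^^ j) f (Suc x) = ?u j + ?u (Suc j)" for j
    by (simp only: forward_diff_Suc) simp
  have "f (x + Suc m) = (\<Sum>j\<le>m. of_nat (m choose j) * (?u j + ?u (Suc j)))"
    using Suc[of "Suc x"] by (simp add: step del: funpow.simps)
  also have "\<dots> = (\<Sum>j\<le>m. of_nat (m choose j) * ?u j) + (\<Sum>j\<le>m. of_nat (m choose j) * ?u (Suc j))"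
    by (simp add: ring_distribs sum.distrib del: funpow.simps)
  also have "(\<Sum>j\<le>m. of_nat (m choose j) * ?u j) = (\<Sum>j\<le>Suc m. of_nat (m choose j) * ?u j)"
    by (simp add: binomial_eq_0)
  also have "\<dots> = ?u 0 + (\<Sum>j\<le>m. of_nat (m choose Suc j) * ?u (Suc j))"
    by (subst sum.atMost_Suc_shift) simp
  also have "\<dots> + (\<Sum>j\<le>m. of_nat (m choose j) * ?u (Suc j))
      = ?u 0 + (\<Sum>j\<le>m. of_nat (Suc m choose Suc j) * ?u (Suc j))"
    by (simp add: ring_distribs sum.distrib add_ac del: funpow.simps)
  also have "\<dots> = (\<Sum>j\<le>Suc m. of_nat (Suc m choose j) * ?u j)"
    by (simp only: sum.atMost_Suc_shift) simp
  finally show ?case .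
qed simp

lemma absval_forward_diff_le:
  fixes g :: "nat \<Rightarrow> 'a::complete_nonarch_field"
  assumes "\<And>x. absval (g x) \<le> M"
  shows "absval ((forward_diff ^^ j) g x) \<le> M"
proof (induction j arbitrary: x)
  case (Suc j)
  show ?case
    using absval_diff[of "(forward_diff ^^ j) g (Suc x)" "(forward_diff ^^ j) g x"]
      Suc[of x] Suc[of "Suc x"] unfolding forward_diff_Suc by linarith
qed (simp add: assms)

lemma forward_diff_almost_periodic:
  fixes g :: "nat \<Rightarrow> 'a::complete_nonarch_field"
  assumes "\<And>x. absval (g (x + q) - g x) \<le> \<epsilon>"
  shows "absval ((forward_diff ^^ j) g (x + q) - (forward_diff ^^ j) g x) \<le> \<epsilon>"
proof -
  have "(forward_diff ^^ j) g (x + q) - (forward_diff ^^ j) g x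
      = (forward_diff ^^ j) (\<lambda>y. g (y + q) - g y) x" for x
  proof (induction j arbitrary: x)
    case (Suc j)
    show ?case
      using Suc[of x] Suc[of "Suc x"]
      by (simp add: forward_diff_Suc algebra_simps del: funpow.simps)
  qed simp
  then show ?thesis
    using absval_forward_diff_le[of "\<lambda>y. g (y + q) - g y"] assms by simp
qed

section \<open>The \<open>p\<close>-adic absolute value and the compactness of \<open>\<int>\<^sub>p\<close>\<close>

locale padic_absval =
  fixes p :: nat and V :: "'a::complete_nonarch_field itself"
  assumes prime_p: "prime p"
    and absval_of_int:
      "k \<noteq> 0 \<Longrightarrow> absval (of_int k :: 'a) = (1 / real p) ^ multiplicity (int p) k"
begin

lemma p_gt_1: "1 < p"
  using prime_p by (rule prime_gt_1_nat)

lemma absval_of_int_le_1: "absval (of_int k :: 'a) \<le> 1"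
  using p_gt_1 absval_of_int[of k] absval_zero_iff[of "0 :: 'a"]
  by (cases "k = 0") (simp_all add: power_le_one)

lemma absval_of_nat_le_1: "absval (of_nat k :: 'a) \<le> 1"
  using absval_of_int_le_1[of "int k"] by simp

lemma absval_p: "absval (of_nat p :: 'a) = 1 / real p"
proof -
  have "multiplicity (int p) (int p) = 1"
    using prime_p p_gt_1 by (intro multiplicity_self) auto
  then show ?thesis
    using absval_of_int[of "int p"] p_gt_1 by simp
qed

lemma absval_dvd_le:
  assumes "int p ^ t dvd k"
  shows "absval (of_int k :: 'a) \<le> (1 / real p) ^ t"
proof -
  obtain c where "k = int p ^ t * c"
    using assms by auto
  then have "absval (of_int k :: 'a) = (1 / real p) ^ t * absval (of_int c :: 'a)"
    by (simp add: absval_mult absval_power absval_p)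
  also have "\<dots> \<le> (1 / real p) ^ t * 1"
    by (intro mult_left_mono absval_of_int_le_1) simp
  finally show ?thesis
    by simp
qed

lemma absval_coprime:
  assumes "\<not> int p dvd k"
  shows "absval (of_int k :: 'a) = 1"
proof -
  have "k \<noteq> 0"
    using assms by auto
  then show ?thesis
    using absval_of_int[of k] not_dvd_imp_multiplicity_0[OF assms] by simp
qed

lemma small_power:
  assumes "0 < e"
  obtains t where "(1 / real p) ^ t < e"
  using real_arch_pow_inv[of e "1 / real p"] assms p_gt_1 by auto

text \<open>
  The residues \<open>0, \<dots>, p\<^sup>t - 1\<close> are a \<open>p\<^sup>-\<^sup>t\<close>-net: a rational \<open>a / b\<close> of absolute value at most \<open>1\<close> has
  \<open>b\<close> prime to \<open>p\<close>, and \<open>b\<close> is invertible modulo \<open>p\<^sup>t\<close>.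
\<close>

lemma Zp_approx_residue:
  assumes "(x :: 'a) \<in> Zp"
  obtains k where "k < p ^ t" and "absval (x - of_nat k) \<le> (1 / real p) ^ t"
proof -
  from assms have x: "x \<in> closure \<rat>" "absval x \<le> 1"
    by (auto simp: Zp_def)
  have pos: "0 < (1 / real p) ^ t"
    using p_gt_1 by simp
  then obtain r where r: "r \<in> \<rat>" "dist r x < (1 / real p) ^ t"
    using x(1) unfolding closure_approachable by blast
  obtain a b where b: "b > 0" "coprime a b" and rab: "r = of_int a / of_int b"
    using r(1) by (rule Rats_cases')
  have rb: "absval r * absval (of_int b :: 'a) = absval (of_int a :: 'a)"
    using b by (simp add: rab flip: absval_mult)
  have "(1 / real p) ^ t \<le> 1"
    using p_gt_1 by (simp add: power_le_one)
  then have r1: "absval r \<le> 1"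
    using absval_add[of "r - x" x] x(2) r(2) by (simp add: dist_absval)
  have ndvd: "\<not> int p dvd b"
  proof
    assume pb: "int p dvd b"
    have "\<not> int p dvd a"
      using coprime_common_divisor[OF b(2) _ pb] p_gt_1 by auto
    then have "absval r * absval (of_int b :: 'a) = 1"
      using rb absval_coprime by simp
    moreover have "absval (of_int b :: 'a) < 1"
      using absval_dvd_le[of 1 b] pb p_gt_1 by (smt (verit) divide_less_eq_1_pos of_nat_1
          of_nat_less_iff power_one_right of_nat_0_le_iff)
    ultimately show False
      using mult_mono[OF r1 order_refl, of "absval (of_int b :: 'a)"] absval_nonneg[of "of_int b :: 'a"]
      by simp
  qed
  then have "coprime b (int p ^ t)"
    using prime_p by (simp add: prime_imp_coprime coprime_commute[of b])
  then obtain u v where uv: "u * b + v * int p ^ t = 1"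
    using bezout_int[of b "int p ^ t"] by auto
  define k where "k = (u * a) mod int p ^ t"
  have k: "0 \<le> k" "k < int p ^ t"
    using p_gt_1 by (simp_all add: k_def)
  have "int p ^ t dvd a - b * k"
  proof -
    have "a - b * k = a * (u * b + v * int p ^ t) - b * k"
      by (simp add: uv)
    also have "\<dots> = b * (u * a - k) + a * v * int p ^ t"
      by (simp add: algebra_simps)
    finally have "a - b * k = b * (u * a - k) + a * v * int p ^ t" .
    moreover have "int p ^ t dvd u * a - k"
      unfolding k_def by (rule dvd_minus_mod)
    ultimately show ?thesis
      by simp
  qed
  then have "absval (of_int (a - b * k) :: 'a) \<le> (1 / real p) ^ t"
    by (rule absval_dvd_le)
  moreover have "of_int (a - b * k) = of_int b * (r - of_int k :: 'a)"
    using b by (simp add: rab field_simps)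
  ultimately have "absval (r - of_int k) \<le> (1 / real p) ^ t"
    using absval_coprime[OF ndvd] by (simp add: absval_mult)
  then have "absval (x - of_int k) \<le> (1 / real p) ^ t"
    using absval_add[of "x - r" "r - of_int k"] r(2) dist_commute[of r x]
    by (simp add: dist_absval)
  moreover have "of_nat (nat k) = (of_int k :: 'a)"
    using k by simp
  moreover have "nat k < p ^ t"
    using k by (simp add: nat_less_iff)
  ultimately show ?thesis
    using that[of "nat k"] by simp
qed

lemma of_int_in_Zp: "(of_int k :: 'a) \<in> Zp"
  using absval_of_int_le_1 closure_subset[of "\<rat> :: 'a set"] Rats_of_int by (auto simp: Zp_def)

lemma of_nat_in_Zp: "(of_nat k :: 'a) \<in> Zp"
  using of_int_in_Zp[of "int k"] by simp

lemma Zp_subset_closure_nat: "(Zp :: 'a set) \<subseteq> closure (range of_nat)"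
proof
  fix x :: 'a
  assume x: "x \<in> Zp"
  show "x \<in> closure (range of_nat)"
    unfolding closure_approachable
  proof (intro allI impI)
    fix e :: real
    assume "0 < e"
    then obtain t where "(1 / real p) ^ t < e"
      by (rule small_power)
    moreover obtain k where "absval (x - of_nat k) \<le> (1 / real p) ^ t"
      using Zp_approx_residue[OF x] .
    ultimately show "\<exists>y\<in>range of_nat. dist y x < e"
      using dist_absval dist_commute by (metis order.strict_trans1 rangeI)
  qed
qed

lemma closed_Zp: "closed (Zp :: 'a set)"
proof -
  have "closed {x :: 'a. absval x \<le> 1}"
    by (intro closed_Collect_le continuous_on_absval continuous_intros)
  then show ?thesis
    unfolding Zp_def by (simp add: Collect_conj_eq closed_Int)
qed

lemma compact_Zp: "compact (Zp :: 'a set)"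
  unfolding compact_eq_totally_bounded
proof (intro conjI allI impI)
  show "complete (Zp :: 'a set)"
    using closed_Zp by (simp add: complete_eq_closed)
next
  fix e :: real
  assume "0 < e"
  then obtain t where t: "(1 / real p) ^ t < e"
    by (rule small_power)
  have "(Zp :: 'a set) \<subseteq> (\<Union>x\<in>of_nat ` {..<p ^ t}. ball x e)"
  proof
    fix x :: 'a
    assume "x \<in> Zp"
    then obtain k where "k < p ^ t" "absval (x - of_nat k) \<le> (1 / real p) ^ t"
      by (rule Zp_approx_residue)
    with t show "x \<in> (\<Union>x\<in>of_nat ` {..<p ^ t}. ball x e)"
      by (force simp: dist_absval[symmetric] dist_commute)
  qed
  then show "\<exists>k. finite k \<and> (Zp :: 'a set) \<subseteq> (\<Union>x\<in>k. ball x e)"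
    by (intro exI[of _ "of_nat ` {..<p ^ t}"]) auto
qed

lemma CZp_bounded:
  assumes "(\<phi> :: 'a \<Rightarrow> 'a) \<in> CZp"
  obtains M where "0 \<le> M" and "\<And>x. x \<in> Zp \<Longrightarrow> absval (\<phi> x) \<le> M"
proof -
  have "compact (\<phi> ` Zp)"
    using assms compact_Zp by (simp add: CZp_def compact_continuous_image)
  then obtain M where "\<And>y. y \<in> \<phi> ` Zp \<Longrightarrow> dist 0 y \<le> M"
    using compact_imp_bounded bounded_any_center by metis
  then have M: "\<And>x. x \<in> Zp \<Longrightarrow> absval (\<phi> x) \<le> M"
    by (force simp: dist_absval absval_uminus)
  moreover have "0 \<le> M"
    using M[OF of_nat_in_Zp[of 0]] absval_nonneg order_trans by blast
  ultimately show ?thesis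
    using that by blast
qed

lemma CZp_almost_periodic:
  assumes "(\<phi> :: 'a \<Rightarrow> 'a) \<in> CZp" and "0 < \<epsilon>"
  obtains t where "\<And>x :: nat. absval (\<phi> (of_nat (x + p ^ t)) - \<phi> (of_nat x)) \<le> \<epsilon>"
proof -
  have "uniformly_continuous_on Zp \<phi>"
    using assms compact_Zp by (simp add: CZp_def compact_uniformly_continuous)
  then obtain d where d: "0 < d"
    "\<And>x y. x \<in> Zp \<Longrightarrow> y \<in> Zp \<Longrightarrow> dist y x < d \<Longrightarrow> dist (\<phi> y) (\<phi> x) < \<epsilon>"
    using assms(2) unfolding uniformly_continuous_on_def by metis
  obtain t where t: "(1 / real p) ^ t < d"
    using small_power[OF d(1)] .
  have "dist (of_nat (x + p ^ t)) (of_nat x :: 'a) < d" for x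
    using t by (simp add: dist_absval absval_power absval_p)
  then show ?thesis
    using that[of t] d(2)[OF of_nat_in_Zp of_nat_in_Zp] unfolding dist_absval
    by (meson less_imp_le)
qed

section \<open>Mahler expansions\<close>

lemma p_dvd_inner_binomial:
  assumes "0 < j" and "j < p ^ t"
  shows "p dvd (p ^ t choose j)"
proof (rule ccontr)
  assume "\<not> p dvd (p ^ t choose j)"
  then have "coprime (p ^ t) (p ^ t choose j)"
    using prime_p by (simp add: prime_imp_coprime)
  moreover have "p ^ t dvd j * (p ^ t choose j)"
    using times_binomial_minus1_eq[OF assms(1), of "p ^ t"] by simp
  ultimately have "p ^ t dvd j"
    by (simp add: coprime_dvd_mult_left_iff)
  with assms show False
    by (auto dest: dvd_imp_le)
qed

text \<open>
  The contraction step: \<open>\<Delta>\<^sup>q\<close> is the \<open>q\<close>-step difference minus the inner terms of \<open>(1 + \<Delta>)\<^sup>q\<close>, whose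
  binomial coefficients are divisible by \<open>p\<close>.
\<close>

lemma forward_diff_contraction:
  fixes g :: "nat \<Rightarrow> 'a"
  assumes M: "\<And>x. absval (g x) \<le> M"
    and per: "\<And>x. absval (g (x + p ^ t) - g x) \<le> \<epsilon>"
  shows "absval ((forward_diff ^^ (p ^ t)) g x) \<le> max \<epsilon> (M / real p)"
proof -
  let ?q = "p ^ t" and ?u = "\<lambda>j. of_nat (p ^ t choose j) * (forward_diff ^^ j) g x"
  have q: "0 < ?q"
    using p_gt_1 by simp
  have "g (x + ?q) = (\<Sum>j\<le>?q. ?u j)"
    by (rule newton_forward)
  also have "{..?q} = insert 0 (insert ?q {1..<?q})"
    using q by auto
  also have "(\<Sum>j\<in>\<dots>. ?u j) = g x + ((forward_diff ^^ ?q) g x + (\<Sum>j\<in>{1..<?q}. ?u j))"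
    using q by simp
  finally have eq: "(forward_diff ^^ ?q) g x = (g (x + ?q) - g x) - (\<Sum>j\<in>{1..<?q}. ?u j)"
    by simp
  have "0 \<le> M"
    using M absval_nonneg order_trans by blast
  have "absval (?u j) \<le> M / real p" if "j \<in> {1..<?q}" for j
  proof -
    have "int p ^ 1 dvd int (?q choose j)"
      using that p_dvd_inner_binomial[of j t] by simp
    then have "absval (of_nat (?q choose j) :: 'a) \<le> 1 / real p"
      using absval_dvd_le by fastforce
    then have "absval (?u j) \<le> 1 / real p * M"
      unfolding absval_mult
      by (intro mult_mono absval_forward_diff_le M) (simp_all add: absval_nonneg)
    then show ?thesis
      by simp
  qed
  then have "absval (\<Sum>j\<in>{1..<?q}. ?u j) \<le> M / real p"
    using \<open>0 \<le> M\<close> by (intro absval_sum_le) simp_all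
  then show ?thesis
    using per[of x] absval_diff[of "g (x + ?q) - g x" "\<Sum>j\<in>{1..<?q}. ?u j"]
    unfolding eq by linarith
qed

text \<open>
  Differencing preserves almost periodicity with the same error \<open>\<epsilon>\<close>, so the contraction step applies
  again to its own output, and \<open>k\<close> steps give the bound \<open>max \<epsilon> (M / p\<^sup>k)\<close>.
\<close>

lemma mahler_coeffs_tendsto_0:
  fixes \<phi> :: "'a \<Rightarrow> 'a"
  assumes "\<phi> \<in> CZp"
  shows "(\<lambda>n. (forward_diff ^^ n) (\<lambda>k. \<phi> (of_nat k)) 0) \<longlonglongrightarrow> 0"
proof -
  let ?f = "\<lambda>k. \<phi> (of_nat k)"
  obtain M where M: "0 \<le> M" "\<And>x. x \<in> Zp \<Longrightarrow> absval (\<phi> x) \<le> M"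
    using CZp_bounded[OF assms] by blast
  have "\<exists>N. \<forall>n\<ge>N. absval ((forward_diff ^^ n) ?f 0) \<le> \<epsilon>" if \<epsilon>: "0 < \<epsilon>" for \<epsilon>
  proof -
    obtain t where per: "\<And>x. absval (?f (x + p ^ t) - ?f x) \<le> \<epsilon>"
      using CZp_almost_periodic[OF assms \<epsilon>] by blast
    have iter: "absval ((forward_diff ^^ (p ^ t * k)) ?f x) \<le> max \<epsilon> (M * (1 / real p) ^ k)" for k x
    proof (induction k arbitrary: x)
      case 0
      then show ?case
        using M(2)[OF of_nat_in_Zp] by (simp add: le_max_iff_disj)
    next
      case (Suc k)
      have "absval ((forward_diff ^^ (p ^ t)) ((forward_diff ^^ (p ^ t * k)) ?f) x)
          \<le> max \<epsilon> (max \<epsilon> (M * (1 / real p) ^ k) / real p)"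
        by (rule forward_diff_contraction) (rule Suc forward_diff_almost_periodic per)+
      also have "\<epsilon> / real p \<le> \<epsilon>"
        using \<epsilon> p_gt_1 by (simp add: field_simps)
      then have "max \<epsilon> (max \<epsilon> (M * (1 / real p) ^ k) / real p) \<le> max \<epsilon> (M * (1 / real p) ^ Suc k)"
        by (auto simp: max_def)
      finally show ?case
        by (simp add: funpow_add)
    qed
    \<comment> \<open>\<open>M + 1\<close> instead of \<open>M\<close>, which may be \<open>0\<close>.\<close>
    have "0 < \<epsilon> / (M + 1)"
      using \<epsilon> M(1) by simp
    then obtain k where "(1 / real p) ^ k < \<epsilon> / (M + 1)"
      by (rule small_power)
    then have "(M + 1) * (1 / real p) ^ k \<le> \<epsilon>"
      using M(1) by (simp add: field_simps)
    moreover have "M * (1 / real p) ^ k \<le> (M + 1) * (1 / real p) ^ k"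
      by (intro mult_right_mono) simp_all
    ultimately have small: "absval ((forward_diff ^^ (p ^ t * k)) ?f x) \<le> \<epsilon>" for x
      using iter[of k x] by linarith
    have "absval ((forward_diff ^^ n) ?f 0) \<le> \<epsilon>" if "p ^ t * k \<le> n" for n
    proof -
      have "(forward_diff ^^ n) ?f = (forward_diff ^^ (n - p ^ t * k)) ((forward_diff ^^ (p ^ t * k)) ?f)"
        using that by (simp flip: funpow_add[THEN fun_cong, unfolded o_apply])
      then show ?thesis
        using absval_forward_diff_le[OF small] by simp
    qed
    then show ?thesis
      by blast
  qed
  then show ?thesis
    unfolding LIMSEQ_def dist_absval diff_0_right by (meson dense order_le_less_trans)
qed

text \<open>
  The bound \<open>\<epsilon>\<close> on the \<open>N\<close>-th remainder holds at natural numbers, where the series is a finite sum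
  and the ultrametric inequality applies; it extends to \<open>Zp\<close> by density.
\<close>

lemma mahler_expansion_exists:
  fixes \<phi> :: "'a \<Rightarrow> 'a"
  assumes "\<phi> \<in> CZp"
  obtains a where "a \<longlonglongrightarrow> 0" and "\<And>x. x \<in> Zp \<Longrightarrow> (\<lambda>n. a n * (x gchoose n)) sums \<phi> x"
proof -
  define a where "a = (\<lambda>n. (forward_diff ^^ n) (\<lambda>k. \<phi> (of_nat k)) 0)"
  have a0: "a \<longlonglongrightarrow> 0"
    using mahler_coeffs_tendsto_0[OF assms] by (simp add: a_def)
  let ?F = "\<lambda>N x. \<Sum>n<N. a n * (x gchoose n)"
  have tail: "absval (\<phi> x - ?F N x) \<le> \<epsilon>"
    if x: "x \<in> Zp" and N: "\<And>n. N \<le> n \<Longrightarrow> absval (a n) \<le> \<epsilon>" for x N \<epsilon>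
  proof -
    have \<epsilon>: "0 \<le> \<epsilon>"
      using N[of N] absval_nonneg order_trans by blast
    let ?C = "{x \<in> Zp. absval (\<phi> x - ?F N x) \<le> \<epsilon>}"
    have "continuous_on Zp (\<lambda>x. absval (\<phi> x - ?F N x))"
      using assms
      by (intro continuous_on_absval continuous_intros continuous_on_gbinomial) (simp add: CZp_def)
    then have "closed ?C"
      using closed_Zp by (intro continuous_on_closed_Collect_le continuous_on_const)
    moreover have "range of_nat \<subseteq> ?C"
    proof safe
      fix m :: nat
      show "of_nat m \<in> (Zp :: 'a set)"
        by (rule of_nat_in_Zp)
      have "\<phi> (of_nat m) = (\<Sum>n\<le>m. a n * (of_nat m gchoose n))"
        using newton_forward[of "\<lambda>k. \<phi> (of_nat k)" 0 m]
        by (simp add: a_def binomial_gbinomial mult.commute)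
      also have "\<dots> = (\<Sum>n<max (Suc m) N. a n * (of_nat m gchoose n))"
        by (rule sum.mono_neutral_left) (auto simp: binomial_eq_0 simp flip: binomial_gbinomial)
      also have "\<dots> = ?F N (of_nat m) + (\<Sum>n\<in>{N..<max (Suc m) N}. a n * (of_nat m gchoose n))"
        using sum.atLeastLessThan_concat[of 0 N "max (Suc m) N" "\<lambda>n. a n * (of_nat m gchoose n)"]
        by (simp add: lessThan_atLeast0)
      finally have "\<phi> (of_nat m) - ?F N (of_nat m)
          = (\<Sum>n\<in>{N..<max (Suc m) N}. a n * (of_nat m gchoose n))"
        by simp
      moreover have "absval (a n * (of_nat m gchoose n)) \<le> \<epsilon>" if "N \<le> n" for n
        using mult_mono[OF N[OF that] absval_of_nat_le_1[of "m choose n"] \<epsilon> absval_nonneg]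
        by (simp add: absval_mult binomial_gbinomial)
      ultimately show "absval (\<phi> (of_nat m) - ?F N (of_nat m)) \<le> \<epsilon>"
        using \<epsilon> by (simp only:) (rule absval_sum_le, simp_all)
    qed
    ultimately have "closure (range of_nat) \<subseteq> ?C"
      by (rule closure_minimal[rotated])
    then show ?thesis
      using x Zp_subset_closure_nat by blast
  qed
  have "(\<lambda>n. a n * (x gchoose n)) sums \<phi> x" if x: "x \<in> Zp" for x
    unfolding sums_def LIMSEQ_def
  proof (intro allI impI)
    fix e :: real
    assume "0 < e"
    then obtain \<epsilon> where \<epsilon>: "0 < \<epsilon>" "\<epsilon> < e"
      using dense by blast
    then obtain N where "\<And>n. N \<le> n \<Longrightarrow> absval (a n) < \<epsilon>"
      using a0 unfolding LIMSEQ_def dist_absval diff_0_right by blast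
    then have "absval (\<phi> x - ?F n x) \<le> \<epsilon>" if "N \<le> n" for n
      using that by (intro tail[OF x] less_imp_le) simp
    then have "dist (\<phi> x) (?F n x) < e" if "N \<le> n" for n
      using le_less_trans[OF _ \<epsilon>(2)] that unfolding dist_absval by blast
    then show "\<exists>N. \<forall>n\<ge>N. dist (?F n x) (\<phi> x) < e"
      by (auto simp: dist_commute)
  qed
  then show ?thesis
    using that a0 by blast
qed

text \<open>
  Uniqueness is triangular: at \<open>x = m\<close> the series stops after the term \<open>n = m\<close>, whose binomial
  coefficient is \<open>1\<close>.
\<close>

lemma mahler_coeffs_eqI:
  fixes \<phi> :: "'a \<Rightarrow> 'a"
  assumes "a \<longlonglongrightarrow> 0" and "\<And>x. x \<in> Zp \<Longrightarrow> (\<lambda>n. a n * (x gchoose n)) sums \<phi> x"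
  shows "mahler_coeffs \<phi> = a"
  unfolding mahler_coeffs_def
proof (rule the_equality)
  fix b :: "nat \<Rightarrow> 'a"
  assume b: "b \<longlonglongrightarrow> 0 \<and> (\<forall>x\<in>Zp. (\<lambda>n. b n * (x gchoose n)) sums \<phi> x)"
  have value_at_nat: "\<phi> (of_nat m) = (\<Sum>n<m. c n * of_nat (m choose n)) + c m"
    if "\<And>x. x \<in> Zp \<Longrightarrow> (\<lambda>n. c n * (x gchoose n)) sums \<phi> x" for c m
  proof -
    have "(\<lambda>n. c n * (of_nat m gchoose n)) sums (\<Sum>n\<le>m. c n * (of_nat m gchoose n))"
      by (rule sums_finite) (auto simp: binomial_eq_0 simp flip: binomial_gbinomial)
    then have "\<phi> (of_nat m) = (\<Sum>n\<le>m. c n * (of_nat m gchoose n))"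
      using that[OF of_nat_in_Zp] sums_unique2 by blast
    then show ?thesis
      by (simp add: lessThan_Suc_atMost[symmetric] flip: binomial_gbinomial)
  qed
  have "b m = a m" for m
  proof (induction m rule: less_induct)
    case (less m)
    then show ?case
      using value_at_nat[of a m] value_at_nat[of b m] assms(2) b by simp
  qed
  then show "b = a"
    by blast
qed (use assms in blast)

lemma of_nat_mult_tendsto_0:
  fixes u :: "nat \<Rightarrow> 'a"
  assumes "u \<longlonglongrightarrow> 0"
  shows "(\<lambda>n. of_nat (k n) * u n) \<longlonglongrightarrow> 0"
proof (rule nonarch_tendsto_iff[THEN iffD2], rule tendsto_sandwich[OF _ _ tendsto_const])
  show "(\<lambda>n. absval (u n)) \<longlonglongrightarrow> 0"
    using assms nonarch_tendsto_iff[of u 0] by simp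
  show "\<forall>\<^sub>F n in sequentially. absval (of_nat (k n) * u n - 0) \<le> absval (u n)"
    by (simp add: absval_mult mult_left_le_one_le absval_of_nat_le_1 absval_nonneg)
qed (simp add: absval_nonneg)

text \<open>
  The absorption identity turns \<open>x * binom (x - 1) n\<close> into a multiple of \<open>binom x (n + 1)\<close>, so no new
  expansion has to be computed: uniqueness identifies the coefficients. At \<open>n = 0\<close> the factor \<open>of_nat n\<close> vanishes, which makes the value \<open>a (0 - 1)\<close> harmless.
\<close>

lemma mahler_coeffs_S_op:
  fixes \<phi> :: "'a \<Rightarrow> 'a"
  assumes a0: "a \<longlonglongrightarrow> 0" and a: "\<And>x. x \<in> Zp \<Longrightarrow> (\<lambda>n. a n * (x gchoose n)) sums \<phi> x"
  shows "mahler_coeffs (S_op \<phi>) = (\<lambda>n. a n - of_nat n * a (n - 1))"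
proof (rule mahler_coeffs_eqI)
  have "(\<lambda>n. a (n - 1)) \<longlonglongrightarrow> 0"
    by (rule LIMSEQ_imp_Suc) (simp add: a0)
  from tendsto_diff[OF a0 of_nat_mult_tendsto_0[OF this, of "\<lambda>n. n"]]
  show "(\<lambda>n. a n - of_nat n * a (n - 1)) \<longlonglongrightarrow> 0"
    by simp
next
  fix x :: 'a
  assume x: "x \<in> Zp"
  have absorb: "x * (a n * ((x - 1) gchoose n)) = of_nat (Suc n) * a n * (x gchoose Suc n)" for n
    using gbinomial_absorption[of n x] by (metis mult.assoc mult.left_commute)
  have partial: "(\<Sum>n<Suc N. (a n - of_nat n * a (n - 1)) * (x gchoose n))
      = (\<Sum>n<Suc N. a n * (x gchoose n)) - x * (\<Sum>n<N. a n * ((x - 1) gchoose n))" for N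
  proof -
    have "(\<Sum>n<Suc N. of_nat n * a (n - 1) * (x gchoose n))
        = x * (\<Sum>n<N. a n * ((x - 1) gchoose n))"
      by (subst sum.lessThan_Suc_shift) (simp add: sum_distrib_left absorb del: of_nat_Suc)
    then show ?thesis
      by (simp only: left_diff_distrib sum_subtractf)
  qed
  have "(\<lambda>N. (\<Sum>n<Suc N. a n * (x gchoose n)) - x * (\<Sum>n<N. a n * ((x - 1) gchoose n)))
      \<longlonglongrightarrow> \<phi> x - x * \<phi> (x - 1)"
    using a[OF x] a[OF Zp_diff_one[OF x]] unfolding sums_def
    by (intro tendsto_diff tendsto_mult tendsto_const LIMSEQ_Suc)
  then show "(\<lambda>n. (a n - of_nat n * a (n - 1)) * (x gchoose n)) sums S_op \<phi> x"
    unfolding sums_def S_op_def partial[symmetric] by (rule LIMSEQ_imp_Suc)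
qed

section \<open>Self-adjointness\<close>

lemma H_series_S_op_nth:
  "fps_nth (H_series (S_op \<psi>)) n
    = fps_nth (H_series \<psi>) n - of_nat (Suc n) * fps_nth (H_series \<psi>) (Suc n)"
proof -
  have shift: "- 1 - of_nat n - 1 = - 1 - (of_nat (Suc n) :: 'b::complete_nonarch_field)"
    by simp
  show ?thesis
    unfolding H_series_def S_op_def fps_nth_Abs_fps shift by (simp add: algebra_simps)
qed

lemma absval_H_series_nth:
  "absval (fps_nth (H_series \<psi>) n) = absval (\<psi> (- 1 - of_nat n))"
  by (simp add: H_series_def absval_mult absval_power absval_uminus absval_one)

lemma suminf_eqI_partial_sums:
  fixes f g :: "nat \<Rightarrow> 'a"
  assumes "(\<lambda>N. (\<Sum>n<N. g n) - (\<Sum>n<N. f n)) \<longlonglongrightarrow> 0"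
  shows "suminf f = suminf g"
proof -
  have "f sums s \<longleftrightarrow> g sums s" for s
    unfolding sums_def
    using tendsto_add[OF assms, of "\<lambda>N. \<Sum>n<N. f n" s]
      tendsto_diff[OF _ assms, of "\<lambda>N. \<Sum>n<N. g n" s] by auto
  then show ?thesis
    by (simp add: suminf_def)
qed

lemma pairing_S_op:
  fixes \<phi> \<psi> :: "'a \<Rightarrow> 'a"
  assumes "\<phi> \<in> CZp" and "\<psi> \<in> CZp"
  shows "pairing (S_op \<phi>) \<psi> = pairing \<phi> (S_op \<psi>)"
proof -
  obtain a where a: "a \<longlonglongrightarrow> 0" "\<And>x. x \<in> Zp \<Longrightarrow> (\<lambda>n. a n * (x gchoose n)) sums \<phi> x"
    using mahler_expansion_exists[OF assms(1)] by blast
  let ?c = "fps_nth (H_series \<psi>)"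
  obtain M where M: "0 \<le> M" "\<And>x. x \<in> Zp \<Longrightarrow> absval (\<psi> x) \<le> M"
    using CZp_bounded[OF assms(2)] by blast
  have c: "absval (?c n) \<le> M" for n
    using M(2)[OF of_int_in_Zp[of "- 1 - int n"]] by (simp add: absval_H_series_nth)
  have "(\<lambda>n. a n * ?c (Suc n)) \<longlonglongrightarrow> 0"
  proof (rule nonarch_tendsto_iff[THEN iffD2], rule tendsto_sandwich[OF _ _ tendsto_const])
    show "(\<lambda>n. absval (a n) * M) \<longlonglongrightarrow> 0"
      using tendsto_mult_left_zero[of "\<lambda>n. absval (a n)"] a(1) nonarch_tendsto_iff[of a 0] by simp
    show "\<forall>\<^sub>F n in sequentially. absval (a n * ?c (Suc n) - 0) \<le> absval (a n) * M"
      by (simp add: absval_mult mult_left_mono c absval_nonneg)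
  qed (simp add: absval_nonneg)
  then have boundary: "(\<lambda>n. of_nat (Suc n) * (a n * ?c (Suc n))) \<longlonglongrightarrow> 0"
    by (rule of_nat_mult_tendsto_0)
  have partial: "(\<Sum>n<N. (a n - of_nat n * a (n - 1)) * ?c n)
      - (\<Sum>n<N. a n * (?c n - of_nat (Suc n) * ?c (Suc n))) = of_nat N * (a (N - 1) * ?c N)" for N
    by (induction N) (simp_all add: algebra_simps)
  have "(\<lambda>N. of_nat N * (a (N - 1) * ?c N)) \<longlonglongrightarrow> 0"
    by (rule LIMSEQ_imp_Suc) (use boundary in simp)
  then have sums_eq: "(\<Sum>n. a n * (?c n - of_nat (Suc n) * ?c (Suc n)))
      = (\<Sum>n. (a n - of_nat n * a (n - 1)) * ?c n)"
    by (intro suminf_eqI_partial_sums) (simp only: partial)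
  have coeffs: "mahler_coeffs \<phi> = a"
    by (rule mahler_coeffs_eqI[OF a(1)]) (rule a(2))
  have coeffs_S: "mahler_coeffs (S_op \<phi>) = (\<lambda>n. a n - of_nat n * a (n - 1))"
    by (rule mahler_coeffs_S_op[OF a(1)]) (rule a(2))
  show ?thesis
    unfolding pairing_def measure_of_fps_def coeffs coeffs_S H_series_S_op_nth
    by (rule sums_eq[symmetric])
qed

end

theorem theorem4p5:
  fixes \<phi> \<psi> :: "'a::complete_nonarch_field \<Rightarrow> 'a" and p :: nat
  assumes "prime p"
    and "is_Cp p TYPE('a)"
    and "\<phi> \<in> CZp"
    and "\<psi> \<in> CZp"
  shows "pairing (S_op \<phi>) \<psi> = pairing \<phi> (S_op \<psi>)"
proof -
  interpret padic_absval p "TYPE('a)"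
    using assms(1,2) by unfold_locales (simp_all add: is_Cp_def)
  show ?thesis
    using assms(3,4) by (rule pairing_S_op)
qed

end
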